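(* There exists a set of at least $8$ mutually quasi-unbiased weighing matrices for parameters $(16,16,4,64)$.
   Context: A weighing matrix of order $n$ and weight $k$ is an $n\times n$ matrix $W$ with entries in $\{1,-1,0\}$ such that $WW^T=kI_n$, where $I_n$ is the identity matrix of order $n$ and $W^T$ is the transpose of $W$. Two weighing matrices $W_1,W_2$ of order $n$ and weight $k$ are quasi-unbiased for parameters $(n,k,l,a)$ if $(1/\sqrt{a})\,W_1W_2^T$ is a weighing matrix (of order $n$) of weight $l$. Weighing matrices $W_1,\ldots,W_f$ of order $n$ and weight $k$ are mutually quasi-unbiased weighing matrices for parameters $(n,k,l,a)$ if any distinct two of them are quasi-unbiased for parameters $(n,k,l,a)$. *)

theory Defs
  imports Complex_Main "Jordan_Normal_Form.Matrix"
begin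

definition weighing_matrix :: "nat \<Rightarrow> nat \<Rightarrow> real mat \<Rightarrow> bool" where
  "weighing_matrix n k W \<longleftrightarrow>
     W \<in> carrier_mat n n \<and>
     (\<forall>i<n. \<forall>j<n. W $$ (i, j) \<in> {1, -1, 0}) \<and>
     W * transpose_mat W = real k \<cdot>\<^sub>m 1\<^sub>m n"

definition quasi_unbiased :: "nat \<Rightarrow> nat \<Rightarrow> nat \<Rightarrow> nat \<Rightarrow> real mat \<Rightarrow> real mat \<Rightarrow> bool" where
  "quasi_unbiased n k l a W1 W2 \<longleftrightarrow>
     weighing_matrix n k W1 \<and> weighing_matrix n k W2 \<and>
     weighing_matrix n l ((1 / sqrt (real a)) \<cdot>\<^sub>m (W1 * transpose_mat W2))"

definition mutually_quasi_unbiased :: "nat \<Rightarrow> nat \<Rightarrow> nat \<Rightarrow> nat \<Rightarrow> real mat set \<Rightarrow> bool" where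
  "mutually_quasi_unbiased n k l a S \<longleftrightarrow>
     (\<forall>W\<in>S. weighing_matrix n k W) \<and> pairwise (quasi_unbiased n k l a) S"

end

theory Submission
  imports Defs "Jordan_Normal_Form.Determinant"
begin

text \<open>
  Index coordinates of length \<open>2 ^ (m + 1)\<close> by pairs \<open>(y, b)\<close>, encoded as \<open>2 y + b\<close>, of a vector \<open>y\<close> in
  \<open>GF(2)\<^sup>m\<close> and a bit \<open>b\<close>, and for \<open>c\<close> in \<open>GF(2)\<^sup>m\<close> multiply every column
  \<open>(y, b)\<close> of the Sylvester-Hadamard matrix by \<open>(-1)\<close> to the power of the quadratic form
  \<open>b (c \<cdot> y)\<close>. For \<open>c \<noteq> d\<close> the forms differ by a form of rank 2, so by orthogonality of
  characters the inner product of row \<open>(u, p)\<close> for \<open>c\<close> with row \<open>(v, q)\<close> for \<open>d\<close> is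
  \<open>2 ^ m ([u + v = 0] + (-1) ^ (p + q) [u + v = c + d])\<close>, where at most one bracket is nonzero.
  The statement is the case \<open>m = 3\<close>.
\<close>

text \<open>The character \<open>(-1) ^ (u \<cdot> x)\<close> of \<open>GF(2) ^ m\<close>. Vectors
  are the low \<open>m\<close> bits of naturals, so vector addition is \<open>xor\<close>.\<close>

definition walsh :: "nat \<Rightarrow> nat \<Rightarrow> nat \<Rightarrow> real" where
  "walsh m u x = (\<Prod>i<m. if bit u i \<and> bit x i then -1 else 1)"

lemma walsh_cases: "walsh m u x = 1 \<or> walsh m u x = -1"
  unfolding walsh_def by (induction m) auto

lemma walsh_0 [simp]: "walsh m 0 x = 1"
  by (simp add: walsh_def)

lemma walsh_xor: "walsh m (xor u v) x = walsh m u x * walsh m v x"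
  unfolding walsh_def prod.distrib [symmetric]
  by (rule prod.cong) (auto simp: bit_xor_iff)

lemma walsh_flip:
  assumes "i < m" "bit u i"
  shows "walsh m u (xor x (2 ^ i)) = - walsh m u x"
proof -
  have "walsh m u (xor x (2 ^ i)) =
      (\<Prod>j<m. (if j = i then -1 else 1) * (if bit u j \<and> bit x j then -1 else 1))"
    unfolding walsh_def using assms(2)
    by (intro prod.cong) (auto simp: bit_xor_iff bit_exp_iff)
  also have "\<dots> = - walsh m u x"
    unfolding prod.distrib walsh_def using assms(1) by (simp)
  finally show ?thesis .
qed

lemma xor_less_exp:
  fixes x y :: nat
  assumes "x < 2 ^ m" "y < 2 ^ m"
  shows "xor x y < 2 ^ m"
proof -
  have "take_bit m (xor x y) = xor x y"
    using assms by (simp only: take_bit_xor take_bit_nat_eq_self)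
  then show ?thesis
    by (simp only: take_bit_nat_eq_self_iff)
qed

text \<open>For nonzero \<open>u\<close>, flipping a coordinate \<open>i\<close> with
  \<open>bit u i\<close> permutes the range and negates every term, so the sum equals its own
  negative. The bound on \<open>u\<close> places this \<open>i\<close> below
  \<open>m\<close>.\<close>

lemma sum_walsh:
  assumes "u < 2 ^ m"
  shows "(\<Sum>x<2 ^ m. walsh m u x) = (if u = 0 then 2 ^ m else 0)"
proof (cases "u = 0")
  case False
  then obtain i where i: "bit u i"
    by (metis bit_eqI bit_0_eq bot_apply bot_bool_def)
  have "i < m"
    using i assms by (metis bit_take_bit_iff take_bit_nat_eq_self_iff)
  then have "(2 :: nat) ^ i < 2 ^ m"
    by simp
  have "(\<Sum>x<2 ^ m. walsh m u x) = (\<Sum>x<2 ^ m. - walsh m u x)"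
    by (rule sum.reindex_bij_witness [of _ "\<lambda>x. xor x (2 ^ i)" "\<lambda>x. xor x (2 ^ i)"])
      (use \<open>i < m\<close> i \<open>2 ^ i < 2 ^ m\<close> in
        \<open>auto simp: walsh_flip xor_less_exp xor.assoc\<close>)
  then show ?thesis
    using False by (simp add: sum_negf)
qed simp

definition twisted_sylvester :: "nat \<Rightarrow> nat \<Rightarrow> real mat" where
  "twisted_sylvester m c = mat (2 * 2 ^ m) (2 * 2 ^ m) (\<lambda>(i, j).
     (if odd i \<and> odd j then -1 else 1) * walsh m (i div 2) (j div 2) *
     (if odd j then walsh m c (j div 2) else 1))"

lemma dim_twisted_sylvester [simp]:
  "dim_row (twisted_sylvester m c) = 2 * 2 ^ m"
  "dim_col (twisted_sylvester m c) = 2 * 2 ^ m"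
  unfolding twisted_sylvester_def by (simp_all only: dim_row_mat dim_col_mat)

lemma twisted_sylvester_carrier [simp]:
  "twisted_sylvester m c \<in> carrier_mat (2 * 2 ^ m) (2 * 2 ^ m)"
  by (intro carrier_matI dim_twisted_sylvester)

text \<open>Groups the columns \<open>(y, 0)\<close> and \<open>(y, 1)\<close> of a row sum by their
  common \<open>y\<close>.\<close>

lemma sum_even_odd:
  fixes f :: "nat \<Rightarrow> 'a::comm_monoid_add"
  shows "(\<Sum>j<2 * n. f j) = (\<Sum>y<n. f (2 * y) + f (2 * y + 1))"
  by (induction n) (simp_all add: add.assoc)

lemma xor_eq_0_iff_nat: "xor u v = 0 \<longleftrightarrow> u = v" for u v :: nat
proof
  assume eq: "xor u v = 0"
  have "u = xor (xor u v) v"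
    by (simp only: xor.assoc xor_self_eq xor.right_neutral)
  then show "u = v"
    by (simp only: eq xor.left_neutral)
qed simp

text \<open>Columns with \<open>b = 0\<close> contribute the sum of the character
  \<open>u + v\<close>. Columns with \<open>b = 1\<close> contribute, up to the sign
  \<open>(-1) ^ (p + q)\<close>, the sum of the character \<open>u + v + c + d\<close>. Each is
  evaluated by \<open>sum_walsh\<close>.\<close>

lemma twisted_sylvester_gram:
  assumes "c < 2 ^ m" "d < 2 ^ m" "i < 2 * 2 ^ m" "j < 2 * 2 ^ m"
  shows "(twisted_sylvester m c * transpose_mat (twisted_sylvester m d)) $$ (i, j) =
    (if i div 2 = j div 2 then 2 ^ m else 0) +
    (if odd i = odd j then 1 else -1) *
    (if xor (i div 2) (j div 2) = xor c d then 2 ^ m else 0)"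
proof -
  let ?u = "i div 2" and ?v = "j div 2" and ?s = "if odd i = odd j then 1 else -1 :: real"
  have u: "?u < 2 ^ m" and v: "?v < 2 ^ m"
    using assms by auto
  have "(twisted_sylvester m c * transpose_mat (twisted_sylvester m d)) $$ (i, j) =
      (\<Sum>k<2 * 2 ^ m. twisted_sylvester m c $$ (i, k) * twisted_sylvester m d $$ (j, k))"
    using assms by (simp add: scalar_prod_def atLeast0LessThan)
  also have "\<dots> = (\<Sum>y<2 ^ m. walsh m ?u y * walsh m ?v y +
      ?s * (walsh m ?u y * walsh m ?v y * (walsh m c y * walsh m d y)))"
    unfolding sum_even_odd using assms
    by (intro sum.cong) (auto simp: twisted_sylvester_def)
  also have "\<dots> = (\<Sum>y<2 ^ m. walsh m (xor ?u ?v) y) +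
      ?s * (\<Sum>y<2 ^ m. walsh m (xor (xor ?u ?v) (xor c d)) y)"
    by (simp add: walsh_xor sum.distrib sum_distrib_left)
  also have "\<dots> = (if ?u = ?v then 2 ^ m else 0) +
      ?s * (if xor ?u ?v = xor c d then 2 ^ m else 0)"
    using assms(1,2) u v by (simp add: sum_walsh xor_less_exp xor_eq_0_iff_nat)
  finally show ?thesis .
qed

lemma weighing_matrix_twisted_sylvester:
  assumes "c < 2 ^ m"
  shows "weighing_matrix (2 * 2 ^ m) (2 * 2 ^ m) (twisted_sylvester m c)"
  unfolding weighing_matrix_def
proof (intro conjI allI impI)
  fix i j :: nat
  assume "i < 2 * 2 ^ m" "j < 2 * 2 ^ m"
  then show "twisted_sylvester m c $$ (i, j) \<in> {1, -1, 0}"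
    using walsh_cases [of m "i div 2" "j div 2"] walsh_cases [of m c "j div 2"]
    by (auto simp: twisted_sylvester_def)
next
  show "twisted_sylvester m c * transpose_mat (twisted_sylvester m c) =
      real (2 * 2 ^ m) \<cdot>\<^sub>m 1\<^sub>m (2 * 2 ^ m)"
  proof (rule eq_matI)
    fix i j
    assume "i < dim_row (real (2 * 2 ^ m) \<cdot>\<^sub>m 1\<^sub>m (2 * 2 ^ m))"
      and "j < dim_col (real (2 * 2 ^ m) \<cdot>\<^sub>m 1\<^sub>m (2 * 2 ^ m))"
    then have ij: "i < 2 * 2 ^ m" "j < 2 * 2 ^ m"
      by simp_all
    \<comment> \<open>For \<open>c = d\<close> both brackets of the Gram formula test
      \<open>u = v\<close>: the two terms add up if the parities agree and cancel if they
      differ.\<close>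
    have "i = j \<longleftrightarrow> i div 2 = j div 2 \<and> odd i = odd j"
      by (metis even_two_times_div_two odd_two_times_div_two_succ)
    then show "(twisted_sylvester m c * transpose_mat (twisted_sylvester m c)) $$ (i, j) =
        (real (2 * 2 ^ m) \<cdot>\<^sub>m 1\<^sub>m (2 * 2 ^ m)) $$ (i, j)"
      using ij by (simp add: twisted_sylvester_gram [OF assms assms ij] xor_eq_0_iff_nat
        del: index_mult_mat)
  qed simp_all
qed (rule twisted_sylvester_carrier)

lemma smult_smult_mat: "a \<cdot>\<^sub>m (b \<cdot>\<^sub>m A) = (a * b) \<cdot>\<^sub>m A" for A :: "'a::semigroup_mult mat"
  by (rule eq_matI) (auto simp: mult.assoc)

lemma one_smult_mat: "1 \<cdot>\<^sub>m A = A" for A :: "'a::monoid_mult mat"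
  by (rule eq_matI) auto

text \<open>The scaled transpose is a right inverse of \<open>W\<close>, and for square matrices
  over a field a right inverse is also a left inverse.\<close>

lemma weighing_matrix_transpose_mult:
  assumes "weighing_matrix n k W" "k > 0"
  shows "transpose_mat W * W = real k \<cdot>\<^sub>m 1\<^sub>m n"
proof -
  have W: "W \<in> carrier_mat n n" and WWT: "W * transpose_mat W = real k \<cdot>\<^sub>m 1\<^sub>m n"
    using assms(1) by (auto simp: weighing_matrix_def)
  let ?V = "(1 / real k) \<cdot>\<^sub>m transpose_mat W"
  have V: "?V \<in> carrier_mat n n"
    using W by simp
  have "W * ?V = (1 / real k) \<cdot>\<^sub>m (W * transpose_mat W)"
    using W by (intro mult_smult_distrib) auto
  also have "\<dots> = 1\<^sub>m n"
    using assms(2) by (simp add: WWT smult_smult_mat one_smult_mat)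
  finally have "?V * W = 1\<^sub>m n"
    using mat_mult_left_right_inverse [OF W V] by blast
  moreover have "?V * W = (1 / real k) \<cdot>\<^sub>m (transpose_mat W * W)"
    using W by (intro mult_smult_assoc_mat) auto
  ultimately have inv: "(1 / real k) \<cdot>\<^sub>m (transpose_mat W * W) = 1\<^sub>m n"
    by (simp only:)
  have "transpose_mat W * W = real k \<cdot>\<^sub>m ((1 / real k) \<cdot>\<^sub>m (transpose_mat W * W))"
    using assms(2) unfolding smult_smult_mat by (simp add: one_smult_mat)
  then show ?thesis
    by (simp only: inv)
qed

text \<open>Orthogonality of the scaled product is automatic: \<open>W2\<close> also has orthogonal
  columns, so the middle factor of \<open>W1 * (transpose_mat W2 * W2) * transpose_mat W1\<close> is
  scalar and the whole is \<open>k * k = l * a\<close> times the identity. Only the entries need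
  checking.\<close>

lemma quasi_unbiasedI:
  assumes W1: "weighing_matrix n k W1" and W2: "weighing_matrix n k W2"
    and "k > 0" "a > 0" and kla: "k * k = l * a"
    and entries: "\<And>i j. i < n \<Longrightarrow> j < n \<Longrightarrow>
      (W1 * transpose_mat W2) $$ (i, j) \<in> {sqrt (real a), - sqrt (real a), 0}"
  shows "quasi_unbiased n k l a W1 W2"
proof -
  let ?M = "W1 * transpose_mat W2" and ?r = "1 / sqrt (real a)"
  have C1: "W1 \<in> carrier_mat n n" and C2: "W2 \<in> carrier_mat n n"
    using W1 W2 by (auto simp: weighing_matrix_def)
  then have M: "?M \<in> carrier_mat n n"
    by simp
  have "transpose_mat ?M = W2 * transpose_mat W1"
    using C1 C2 by (simp add: transpose_mult [of _ n n _ n])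
  then have "?M * transpose_mat ?M = W1 * transpose_mat W2 * (W2 * transpose_mat W1)"
    by simp
  also have "\<dots> = W1 * (transpose_mat W2 * W2) * transpose_mat W1"
    using C1 C2 by (simp add: assoc_mult_mat [of _ n n _ n _ n])
  also have "\<dots> = real k \<cdot>\<^sub>m (W1 * transpose_mat W1)"
    using C1 \<open>k > 0\<close> by (simp add: weighing_matrix_transpose_mult [OF W2]
      mult_smult_distrib [of _ n n _ n] mult_smult_assoc_mat [of _ n n _ n])
  also have "\<dots> = real (l * a) \<cdot>\<^sub>m 1\<^sub>m n"
    using W1 by (simp add: weighing_matrix_def smult_smult_mat kla [symmetric])
  finally have MMT: "?M * transpose_mat ?M = real (l * a) \<cdot>\<^sub>m 1\<^sub>m n" .
  have tr: "transpose_mat (?r \<cdot>\<^sub>m ?M) = ?r \<cdot>\<^sub>m transpose_mat ?M"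
    by (rule eq_matI) auto
  have "(?r \<cdot>\<^sub>m ?M) * transpose_mat (?r \<cdot>\<^sub>m ?M) = ?r \<cdot>\<^sub>m (?r \<cdot>\<^sub>m (?M * transpose_mat ?M))"
    unfolding tr using M
    by (simp add: mult_smult_distrib [of _ n n _ n] mult_smult_assoc_mat [of _ n n _ n])
  also have "\<dots> = real l \<cdot>\<^sub>m 1\<^sub>m n"
    unfolding MMT using \<open>a > 0\<close> by (simp add: smult_smult_mat)
  finally have "(?r \<cdot>\<^sub>m ?M) * transpose_mat (?r \<cdot>\<^sub>m ?M) = real l \<cdot>\<^sub>m 1\<^sub>m n" .
  moreover have "(?r \<cdot>\<^sub>m ?M) $$ (i, j) \<in> {1, -1, 0}" if "i < n" "j < n" for i j
  proof -
    have "(?r \<cdot>\<^sub>m ?M) $$ (i, j) = ?r * ?M $$ (i, j)"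
      using that M by (intro index_smult_mat) auto
    then show ?thesis
      using entries [OF that] \<open>a > 0\<close> by auto
  qed
  ultimately show ?thesis
    using W1 W2 M by (simp add: quasi_unbiased_def weighing_matrix_def)
qed

lemma quasi_unbiased_twisted_sylvester:
  assumes c: "c < 2 ^ m" and d: "d < 2 ^ m" and "c \<noteq> d"
  shows "quasi_unbiased (2 * 2 ^ m) (2 * 2 ^ m) 4 ((2 ^ m)\<^sup>2)
    (twisted_sylvester m c) (twisted_sylvester m d)"
proof (rule quasi_unbiasedI)
  fix i j :: nat
  assume ij: "i < 2 * 2 ^ m" "j < 2 * 2 ^ m"
  \<comment> \<open>If both held, \<open>xor c d\<close> would be 0. Hence the two terms of size
    \<open>2 ^ m\<close> never meet.\<close>
  have "\<not> (i div 2 = j div 2 \<and> xor (i div 2) (j div 2) = xor c d)"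
    using \<open>c \<noteq> d\<close> by (metis xor_eq_0_iff_nat)
  then show "(twisted_sylvester m c * transpose_mat (twisted_sylvester m d)) $$ (i, j) \<in>
      {sqrt (real ((2 ^ m)\<^sup>2)), - sqrt (real ((2 ^ m)\<^sup>2)), 0}"
    unfolding twisted_sylvester_gram [OF c d ij] by auto
qed (use c d in \<open>simp_all add: weighing_matrix_twisted_sylvester power2_eq_square\<close>)

lemma inj_on_twisted_sylvester: "inj_on (twisted_sylvester m) {..<2 ^ m}"
proof (rule inj_onI)
  fix c d
  assume "c \<in> {..<2 ^ m}" "d \<in> {..<2 ^ m}"
    and eq: "twisted_sylvester m c = twisted_sylvester m d"
  then have c: "c < 2 ^ m" and d: "d < 2 ^ m"
    by auto
  have "(0 :: nat) < 2 * 2 ^ m"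
    by simp
  note gram = twisted_sylvester_gram [OF _ _ this this]
  \<comment> \<open>Entry \<open>(0, 0)\<close> of the Gram matrix is computed once from
    \<open>c\<close> and \<open>d\<close> and once from \<open>d\<close> alone; the common summand
    \<open>2 ^ m\<close> cancels.\<close>
  have "(if 0 = xor c d then 2 ^ m else 0) = (2 ^ m :: real)"
    using trans [OF gram [OF c d, unfolded eq, symmetric] gram [OF d d]] by simp
  then have "xor c d = 0"
    by (simp split: if_splits)
  then show "c = d"
    by (simp only: xor_eq_0_iff_nat)
qed

lemma mutually_quasi_unbiased_twisted_sylvester:
  "mutually_quasi_unbiased (2 * 2 ^ m) (2 * 2 ^ m) 4 ((2 ^ m)\<^sup>2)
    (twisted_sylvester m ` {..<2 ^ m})"
  unfolding mutually_quasi_unbiased_def pairwise_def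
proof (intro conjI ballI impI)
  fix W
  assume "W \<in> twisted_sylvester m ` {..<2 ^ m}"
  then show "weighing_matrix (2 * 2 ^ m) (2 * 2 ^ m) W"
    by (elim imageE) (simp only: lessThan_iff weighing_matrix_twisted_sylvester)
next
  fix V W
  assume "V \<in> twisted_sylvester m ` {..<2 ^ m}" "W \<in> twisted_sylvester m ` {..<2 ^ m}" "V \<noteq> W"
  then obtain c d where "V = twisted_sylvester m c" "W = twisted_sylvester m d"
    and "c < 2 ^ m" "d < 2 ^ m" "c \<noteq> d"
    by blast
  then show "quasi_unbiased (2 * 2 ^ m) (2 * 2 ^ m) 4 ((2 ^ m)\<^sup>2) V W"
    by (simp only: quasi_unbiased_twisted_sylvester not_False_eq_True)
qed

theorem corollary5:
  "\<exists>S :: real mat set. finite S \<and> card S \<ge> 8 \<and> mutually_quasi_unbiased 16 16 4 64 S"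
proof (intro exI conjI)
  show "card (twisted_sylvester 3 ` {..<2 ^ 3}) \<ge> 8"
    unfolding card_image [OF inj_on_twisted_sylvester] by simp
  \<comment> \<open>Here \<open>2 * 2 ^ 3 = 16\<close> is both order and weight, and
    \<open>8 * 8 = 64\<close>.\<close>
  show "mutually_quasi_unbiased 16 16 4 64 (twisted_sylvester 3 ` {..<2 ^ 3})"
    using mutually_quasi_unbiased_twisted_sylvester [of 3] by simp
qed simp

end
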